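(* Every semidominant monomial ideal of $S$ is Scarf.
   Context: $S$ is a polynomial ring in finitely many variables over an arbitrary field. Given a set $G$ of monomials, $m\in G$ is dominant (with respect to $G$) if there are a variable $x$ and an integer $k\ge1$ with $x^k\mid m$ and $x^k\nmid m'$ for all $m'\in G\setminus\{m\}$. A set of monomials is semidominant if exactly one of its elements is not dominant; a monomial ideal is semidominant if its minimal generating set is semidominant. For a monomial ideal $M$ with minimal generating set $G=\{l_1,\dots,l_p\}$, the Taylor resolution $\mathbb{T}_M$ is the multigraded free resolution of $S/M$ whose free module in homological degree $j$ has basis the symbols $[l_{r_1},\dots,l_{r_j}]$, $r_1<\dots<r_j$ (one for each $j$-element subset of $G$), with $\operatorname{mdeg}[l_{r_1},\dots,l_{r_j}]=\operatorname{lcm}(l_{r_1},\dots,l_{r_j})$, and differential $f_j([l_{r_1},\dots,l_{r_j}])=\sum_{i=1}^j(-1)^{i+1}\frac{\operatorname{mdeg}[l_{r_1},\dots,l_{r_j}]}{\operatorname{mdeg}[l_{r_1},\dots,\widehat{l_{r_i}},\dots,l_{r_j}]}[l_{r_1},\dots,\widehat{l_{r_i}},\dots,l_{r_j}]$. The Scarf complex of $M$ is the subcomplex of $\mathbb{T}_M$ spanned by the basis elements $[\sigma]$ whose multidegree is not shared by any other basis element of $\mathbb{T}_M$. The ideal $M$ is Scarf if its Scarf complex is a minimal free resolution of $S/M$. *)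

theory Defs
  imports Complex_Main "HOL-Library.Poly_Mapping"
begin

text \<open>
  A monomial is represented by its exponent vector.  The polynomial ring over \<open>'k\<close> in the
  variables \<open>'v\<close> (with \<open>'v\<close> of class finite in the theorem) is the monoid algebra of the
  exponent vectors.
\<close>

type_synonym 'v mono = "'v \<Rightarrow>\<^sub>0 nat"

type_synonym ('v, 'k) mpol = "'v mono \<Rightarrow>\<^sub>0 'k"

definition monomial :: "'v mono \<Rightarrow> ('v, 'k::field) mpol"
  where "monomial a = Poly_Mapping.single a 1"

definition mono_dvd :: "'v mono \<Rightarrow> 'v mono \<Rightarrow> bool"
  where "mono_dvd a b \<longleftrightarrow> (\<exists>c. b = a + c)"

text \<open>Only meaningful for finite sets; the least common multiple of the empty set is \<open>1\<close>.\<close>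

definition mono_lcm :: "('v::finite) mono set \<Rightarrow> 'v mono"
  where "mono_lcm A =
    Poly_Mapping.Abs_poly_mapping (\<lambda>x. Max (insert 0 ((\<lambda>a. Poly_Mapping.lookup a x) ` A)))"

definition ideal_gen :: "'r::comm_ring_1 set \<Rightarrow> 'r set"
  where "ideal_gen A = module.span (*) A"

definition monomial_ideal :: "('v, 'k::field) mpol set \<Rightarrow> bool"
  where "monomial_ideal M \<longleftrightarrow> (\<exists>A. M = ideal_gen (monomial ` A))"

definition is_min_gens :: "('v, 'k::field) mpol set \<Rightarrow> 'v mono set \<Rightarrow> bool"
  where "is_min_gens M G \<longleftrightarrow>
    ideal_gen (monomial ` G) = M \<and> (\<forall>H. H \<subset> G \<longrightarrow> ideal_gen (monomial ` H) \<noteq> M)"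

text \<open>A monomial ideal has exactly one irredundant set of monomial generators.\<close>

definition min_gens :: "('v, 'k::field) mpol set \<Rightarrow> 'v mono set"
  where "min_gens M = (THE G. is_min_gens M G)"


definition dominant :: "'v mono set \<Rightarrow> 'v mono \<Rightarrow> bool"
  where "dominant G m \<longleftrightarrow> m \<in> G \<and>
    (\<exists>x k. 1 \<le> k \<and> mono_dvd (Poly_Mapping.single x k) m \<and>
      (\<forall>m' \<in> G - {m}. \<not> mono_dvd (Poly_Mapping.single x k) m'))"

definition semidominant_set :: "'v mono set \<Rightarrow> bool"
  where "semidominant_set G \<longleftrightarrow> (\<exists>!m. m \<in> G \<and> \<not> dominant G m)"

definition semidominant_ideal :: "('v, 'k::field) mpol set \<Rightarrow> bool"
  where "semidominant_ideal M \<longleftrightarrow> monomial_ideal M \<and> semidominant_set (min_gens M)"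


text \<open>
  All free modules live inside the free module \<open>'b \<Rightarrow>\<^sub>0 'r\<close> on the whole type \<open>'b\<close>: the basis
  element \<open>b\<close> is \<open>Poly_Mapping.single b 1\<close>.
\<close>

definition fscale :: "'r::comm_ring_1 \<Rightarrow> ('b \<Rightarrow>\<^sub>0 'r) \<Rightarrow> ('b \<Rightarrow>\<^sub>0 'r)"
  where "fscale s c = Poly_Mapping.map ((*) s) c"

lemma lookup_fscale: "Poly_Mapping.lookup (fscale s c) b = s * Poly_Mapping.lookup c b"
  by (simp add: fscale_def Poly_Mapping.map.rep_eq when_def)

lemma module_fscale: "module (fscale :: 'r::comm_ring_1 \<Rightarrow> ('b \<Rightarrow>\<^sub>0 'r) \<Rightarrow> _)"
  by unfold_locales
    (auto intro!: poly_mapping_eqI simp: lookup_fscale lookup_add algebra_simps)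

definition free_on :: "'b set \<Rightarrow> ('b \<Rightarrow>\<^sub>0 'r::comm_ring_1) set"
  where "free_on B = {c. Poly_Mapping.keys c \<subseteq> B}"

text \<open>
  The complex \<open>\<cdots> \<rightarrow> F\<^sub>2 \<rightarrow> F\<^sub>1 \<rightarrow> F\<^sub>0\<close> has \<open>F\<^sub>j\<close> free with basis \<open>B j\<close>, and all its differentials are
  restrictions of one linear map \<open>d\<close>.  The augmentation \<open>F\<^sub>0 \<rightarrow> S/M\<close> is given by a linear map
  \<open>\<epsilon>\<close> into \<open>S\<close> followed by the projection, so that its kernel is \<open>{c \<in> F\<^sub>0. \<epsilon> c \<in> M}\<close> and its
  surjectivity is a statement modulo \<open>M\<close>.
\<close>

definition free_resolution ::
    "(nat \<Rightarrow> 'b set) \<Rightarrow> (('b \<Rightarrow>\<^sub>0 'r) \<Rightarrow> ('b \<Rightarrow>\<^sub>0 'r)) \<Rightarrow> (('b \<Rightarrow>\<^sub>0 'r) \<Rightarrow> 'r)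
      \<Rightarrow> 'r::comm_ring_1 set \<Rightarrow> bool"
  where "free_resolution B d \<epsilon> M \<longleftrightarrow>
    module_hom fscale fscale d \<and>
    module_hom fscale (*) \<epsilon> \<and>
    (\<forall>j. d ` free_on (B (Suc j)) \<subseteq> free_on (B j)) \<and>
    (\<forall>j \<ge> 1. {c \<in> free_on (B j). d c = 0} = d ` free_on (B (Suc j))) \<and>
    {c \<in> free_on (B 0). \<epsilon> c \<in> M} = d ` free_on (B 1) \<and>
    (\<forall>s. \<exists>c \<in> free_on (B 0). s - \<epsilon> c \<in> M)"

text \<open>
  If the basis element \<open>b\<close> is placed in multidegree \<open>deg b\<close>, then \<open>d\<close> and \<open>\<epsilon>\<close> preserve
  multidegrees.
\<close>

definition multigraded ::
    "(nat \<Rightarrow> 'b set) \<Rightarrow> ('b \<Rightarrow> 'v mono)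
      \<Rightarrow> (('b \<Rightarrow>\<^sub>0 ('v, 'k) mpol) \<Rightarrow> ('b \<Rightarrow>\<^sub>0 ('v, 'k) mpol))
      \<Rightarrow> (('b \<Rightarrow>\<^sub>0 ('v, 'k) mpol) \<Rightarrow> ('v, 'k::field) mpol) \<Rightarrow> bool"
  where "multigraded B deg d \<epsilon> \<longleftrightarrow>
    (\<forall>j. \<forall>b \<in> B (Suc j). \<forall>b'.
      \<forall>e \<in> Poly_Mapping.keys (Poly_Mapping.lookup (d (Poly_Mapping.single b 1)) b').
        e + deg b' = deg b) \<and>
    (\<forall>b \<in> B 0. \<forall>e \<in> Poly_Mapping.keys (\<epsilon> (Poly_Mapping.single b 1)). e = deg b)"

definition irrelevant_ideal :: "('v, 'k::field) mpol set"
  where "irrelevant_ideal = ideal_gen (range (\<lambda>x. monomial (Poly_Mapping.single x 1)))"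

definition minimal_complex ::
    "(nat \<Rightarrow> 'b set) \<Rightarrow> (('b \<Rightarrow>\<^sub>0 ('v, 'k::field) mpol) \<Rightarrow> ('b \<Rightarrow>\<^sub>0 ('v, 'k) mpol)) \<Rightarrow> bool"
  where "minimal_complex B d \<longleftrightarrow>
    (\<forall>j. d ` free_on (B (Suc j)) \<subseteq>
      module.span fscale {fscale s c | s c. s \<in> irrelevant_ideal \<and> c \<in> free_on (B j)})"

definition minimal_free_resolution ::
    "(nat \<Rightarrow> 'b set) \<Rightarrow> ('b \<Rightarrow> 'v mono)
      \<Rightarrow> (('b \<Rightarrow>\<^sub>0 ('v, 'k) mpol) \<Rightarrow> ('b \<Rightarrow>\<^sub>0 ('v, 'k) mpol))
      \<Rightarrow> (('b \<Rightarrow>\<^sub>0 ('v, 'k) mpol) \<Rightarrow> ('v, 'k) mpol) \<Rightarrow> ('v, 'k::field) mpol set \<Rightarrow> bool"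
  where "minimal_free_resolution B deg d \<epsilon> M \<longleftrightarrow>
    free_resolution B d \<epsilon> M \<and> multigraded B deg d \<epsilon> \<and> minimal_complex B d"


text \<open>
  The Taylor complex depends on an enumeration \<open>l\<^sub>1, \<dots>, l\<^sub>p\<close> of the generators, given as a list
  \<open>ls\<close> (indexed from \<open>0\<close>).  The basis symbol \<open>[l\<^sub>r\<^sub>1, \<dots>, l\<^sub>r\<^sub>j]\<close> is the index set
  \<open>{r\<^sub>1, \<dots>, r\<^sub>j}\<close>.
\<close>

definition taylor_basis :: "'v mono list \<Rightarrow> nat \<Rightarrow> nat set set"
  where "taylor_basis ls j = {\<sigma>. \<sigma> \<subseteq> {..<length ls} \<and> card \<sigma> = j}"

definition taylor_mdeg :: "('v::finite) mono list \<Rightarrow> nat set \<Rightarrow> 'v mono"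
  where "taylor_mdeg ls \<sigma> = mono_lcm ((!) ls ` \<sigma>)"

text \<open>
  If \<open>r\<close> is the \<open>i\<close>-th smallest element of \<open>\<sigma>\<close>, then \<open>(-1)\<^sup>i\<^sup>+\<^sup>1 = (-1)\<^sup>i\<^sup>-\<^sup>1\<close> and \<open>i - 1\<close> elements
  of \<open>\<sigma>\<close> are below \<open>r\<close>.  The quotient of multidegrees is a difference of exponent vectors; it
  is never truncated, as the lcm of a subset divides that of the whole set.
\<close>

definition taylor_diff_basis ::
    "('v::finite) mono list \<Rightarrow> nat set \<Rightarrow> (nat set \<Rightarrow>\<^sub>0 ('v, 'k::field) mpol)"
  where "taylor_diff_basis ls \<sigma> =
    (\<Sum>r\<in>\<sigma>. Poly_Mapping.single (\<sigma> - {r})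
      ((-1) ^ card {s \<in> \<sigma>. s < r} * monomial (taylor_mdeg ls \<sigma> - taylor_mdeg ls (\<sigma> - {r}))))"

definition taylor_diff ::
    "('v::finite) mono list \<Rightarrow> (nat set \<Rightarrow>\<^sub>0 ('v, 'k::field) mpol) \<Rightarrow> (nat set \<Rightarrow>\<^sub>0 ('v, 'k) mpol)"
  where "taylor_diff ls c =
    (\<Sum>\<sigma>\<in>Poly_Mapping.keys c. fscale (Poly_Mapping.lookup c \<sigma>) (taylor_diff_basis ls \<sigma>))"

text \<open>The augmentation sends \<open>[]\<close>, the basis element in homological degree \<open>0\<close>, to \<open>1\<close>.\<close>

definition taylor_aug :: "(nat set \<Rightarrow>\<^sub>0 ('v, 'k::field) mpol) \<Rightarrow> ('v, 'k) mpol"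
  where "taylor_aug c = Poly_Mapping.lookup c {}"

definition scarf_basis :: "('v::finite) mono list \<Rightarrow> nat \<Rightarrow> nat set set"
  where "scarf_basis ls j =
    {\<sigma> \<in> taylor_basis ls j.
      \<forall>i. \<forall>\<tau> \<in> taylor_basis ls i. taylor_mdeg ls \<tau> = taylor_mdeg ls \<sigma> \<longrightarrow> \<tau> = \<sigma>}"

text \<open>
  The generators carry no preferred enumeration, so all of them are considered.  Finiteness
  holds for every monomial ideal by Dickson's lemma; it is stated so that an enumeration exists.
\<close>

definition scarf_ideal :: "('v::finite, 'k::field) mpol set \<Rightarrow> bool"
  where "scarf_ideal M \<longleftrightarrow> monomial_ideal M \<and> finite (min_gens M) \<and>
    (\<forall>ls. distinct ls \<and> set ls = min_gens M \<longrightarrow>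
      minimal_free_resolution (scarf_basis ls) (taylor_mdeg ls) (taylor_diff ls) taylor_aug M)"

end

theory Submission
  imports Defs
begin

text \<open>
  A dominant generator divides the lcm of a set of generators only if it belongs to the set, because
  it alone is divisible by its own power \<open>x\<^sup>k\<close>.  So two sets of generators with the same lcm contain
  the same dominant generators.  If \<open>m\<close> is the only non-dominant generator, they can differ at most in
  \<open>m\<close>, and they do so exactly when \<open>m\<close> divides the lcm of the others.  Hence a set \<open>\<sigma>\<close> is a Scarf
  face iff \<open>m\<close> does not divide the lcm of \<open>\<sigma> - {m}\<close> (lemma \<open>scarf_basis_semidominant\<close>): the Scarf
  faces form a cone with apex \<open>m\<close>.

  Exactness is a matter of contracting each multidegree \<open>b\<close> separately.  The faces visible in
  multidegree \<open>b\<close> are those whose lcm divides \<open>b\<close>.  If \<open>m\<close> divides \<open>b\<close>, inserting \<open>m\<close> leads from a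
  visible Scarf face to a visible Scarf face.  If \<open>m\<close> does not divide \<open>b\<close>, then \<open>m\<close> divides no
  divisor of \<open>b\<close>, so every set of generators dividing \<open>b\<close> is a Scarf face, and any generator dividing
  \<open>b\<close> can be inserted.  In both cases there is one generator, depending only on \<open>b\<close>, whose signed
  insertion \<open>h\<close> satisfies \<open>d h + h d = 1\<close> (lemma \<open>insert_vertex_homotopy\<close>), so that a cycle \<open>c\<close> is
  the boundary of \<open>h c\<close> (lemma \<open>free_resolution_if_contractible\<close>).  Such a generator exists whenever
  \<open>b\<close> is the exponent of a monomial of the ideal, which is the case in positive homological degrees,
  and in degree \<open>0\<close> for the chains that the augmentation sends into the ideal.

  Minimality of the resolution is immediate: a Scarf face and its facets have different multidegrees,
  so no coefficient of the differential is a nonzero constant.  Finiteness of the generating set comes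
  from semidominance itself, as two generators cannot be dominant through the same variable.
\<close>

abbreviation lookup :: "('a \<Rightarrow>\<^sub>0 'b::zero) \<Rightarrow> 'a \<Rightarrow> 'b"
  where "lookup \<equiv> Poly_Mapping.lookup"

abbreviation keys :: "('a \<Rightarrow>\<^sub>0 'b::zero) \<Rightarrow> 'a set"
  where "keys \<equiv> Poly_Mapping.keys"

abbreviation single :: "'a \<Rightarrow> 'b \<Rightarrow> ('a \<Rightarrow>\<^sub>0 'b::zero)"
  where "single \<equiv> Poly_Mapping.single"

section \<open>Finitely supported functions\<close>

lemma sum_single_keys:
  fixes p :: "'a \<Rightarrow>\<^sub>0 'b::comm_monoid_add"
  shows "(\<Sum>a\<in>keys p. single a (lookup p a)) = p"
proof (rule poly_mapping_eqI)
  fix k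
  have "(\<Sum>a\<in>keys p. lookup (single a (lookup p a)) k) = (\<Sum>a\<in>keys p. if a = k then lookup p a else 0)"
    by (rule sum.cong) (auto simp: lookup_single when_def)
  then show "lookup (\<Sum>a\<in>keys p. single a (lookup p a)) k = lookup p k"
    by (simp add: lookup_sum sum.delta in_keys_iff)
qed

lemma poly_mapping_additive_induct:
  fixes p :: "'a \<Rightarrow>\<^sub>0 'b::comm_monoid_add"
  assumes "P 0" and "\<And>p q. P p \<Longrightarrow> P q \<Longrightarrow> P (p + q)"
    and "\<And>a. a \<in> keys p \<Longrightarrow> P (single a (lookup p a))"
  shows "P p"
proof -
  have "P (\<Sum>a\<in>A. single a (lookup p a))" if "finite A" "A \<subseteq> keys p" for A
    using that by (induction A rule: finite_induct) (auto intro: assms)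
  from this[of "keys p"] show ?thesis by (simp add: sum_single_keys)
qed

text \<open>
  The basis elements times scalar multiples of monomials span the chains as an additive group.  The
  contraction below treats each multidegree differently, so it is not linear over the polynomial ring
  and its properties can only be checked on these multigraded pieces.
\<close>

lemma poly_chain_additive_induct:
  fixes c :: "'b \<Rightarrow>\<^sub>0 ('v, 'k::field) mpol"
  assumes zero: "P 0" and add: "\<And>c c'. P c \<Longrightarrow> P c' \<Longrightarrow> P (c + c')"
    and single: "\<And>\<sigma> e a. \<sigma> \<in> keys c \<Longrightarrow> e \<in> keys (lookup c \<sigma>) \<Longrightarrow> P (single \<sigma> (single e a))"
  shows "P c"
proof (rule poly_mapping_additive_induct[of P, OF zero add])
  fix \<sigma> assume \<sigma>: "\<sigma> \<in> keys c"
  show "P (single \<sigma> (lookup c \<sigma>))"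
    by (rule poly_mapping_additive_induct[of "\<lambda>p. P (single \<sigma> p)"])
      (auto simp: zero single_add add single \<sigma>)
qed

text \<open>
  Additive maps on a direct sum of copies of \<open>'b\<close> arise in this way from their restrictions \<open>F a\<close> to
  the summands.
\<close>

definition additive_ext :: "('a \<Rightarrow> 'b::zero \<Rightarrow> 'c::comm_monoid_add) \<Rightarrow> ('a \<Rightarrow>\<^sub>0 'b) \<Rightarrow> 'c"
  where "additive_ext F p = (\<Sum>a\<in>keys p. F a (lookup p a))"

lemma additive_ext_superset:
  assumes "\<And>a. F a 0 = 0" "finite A" "keys p \<subseteq> A"
  shows "additive_ext F p = (\<Sum>a\<in>A. F a (lookup p a))"
  unfolding additive_ext_def
  by (rule sum.mono_neutral_left) (use assms in \<open>auto simp: in_keys_iff\<close>)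

lemma additive_ext_add:
  fixes p q :: "'a \<Rightarrow>\<^sub>0 'b::monoid_add"
  assumes "\<And>a. F a 0 = 0" "\<And>a x y. F a (x + y) = F a x + F a y"
  shows "additive_ext F (p + q) = additive_ext F p + additive_ext F q"
proof -
  let ?A = "keys p \<union> keys q"
  have "keys (p + q) \<subseteq> ?A" by (rule keys_add)
  then show ?thesis
    using additive_ext_superset[of F ?A, OF assms(1)]
    by (simp add: lookup_add assms(2) sum.distrib)
qed

lemma additive_ext_0 [simp]: "additive_ext F 0 = 0"
  by (simp add: additive_ext_def)

lemma additive_ext_single:
  assumes "F a 0 = 0"
  shows "additive_ext F (single a x) = F a x"
  using assms by (cases "x = 0") (simp_all add: additive_ext_def)

lemma free_on_0 [simp]: "0 \<in> free_on B"
  by (simp add: free_on_def)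

lemma free_on_add: "c \<in> free_on B \<Longrightarrow> c' \<in> free_on B \<Longrightarrow> c + c' \<in> free_on B"
  using keys_add[of c c'] by (auto simp: free_on_def)

lemma free_on_single: "\<sigma> \<in> B \<Longrightarrow> single \<sigma> p \<in> free_on B"
  by (auto simp: free_on_def split: if_splits)

lemma free_on_sum: "(\<And>i. i \<in> I \<Longrightarrow> f i \<in> free_on B) \<Longrightarrow> sum f I \<in> free_on B"
  by (induction I rule: infinite_finite_induct) (auto intro: free_on_add)

lemma fscale_single: "fscale s (single b p) = single b (s * p)"
  by (rule poly_mapping_eqI) (auto simp: lookup_fscale lookup_single when_def)

lemma fscale_add: "fscale s (c + c') = fscale s c + fscale s c'"
  and fscale_add_left: "fscale (s + t) c = fscale s c + fscale t c"
  and fscale_zero [simp]: "fscale s 0 = 0"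
  and fscale_0_left [simp]: "fscale 0 c = 0"
  and fscale_fscale: "fscale s (fscale t c) = fscale (s * t) c"
  by (rule poly_mapping_eqI; simp add: lookup_fscale lookup_add algebra_simps)+

lemma fscale_sum: "fscale s (sum f I) = (\<Sum>i\<in>I. fscale s (f i))"
  by (induction I rule: infinite_finite_induct) (auto simp: fscale_add)

section \<open>Monomials and monomial ideals\<close>

lemma mono_dvd_iff_lookup_le: "mono_dvd a b \<longleftrightarrow> (\<forall>x. lookup a x \<le> lookup b x)"
proof
  assume "\<forall>x. lookup a x \<le> lookup b x"
  then have "b = a + (b - a)"
    by (intro poly_mapping_eqI) (simp add: lookup_add lookup_minus)
  then show "mono_dvd a b" unfolding mono_dvd_def by blast
qed (auto simp: mono_dvd_def lookup_add)

lemma mono_dvd_refl: "mono_dvd a a"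
  by (simp add: mono_dvd_iff_lookup_le)

lemma mono_dvd_trans: "mono_dvd a b \<Longrightarrow> mono_dvd b c \<Longrightarrow> mono_dvd a c"
  by (meson mono_dvd_iff_lookup_le le_trans)

lemma mono_dvd_add: "mono_dvd a (e + a)"
  by (simp add: mono_dvd_iff_lookup_le lookup_add)

lemma mono_dvd_single_iff: "mono_dvd (single x k) b \<longleftrightarrow> k \<le> lookup b x"
  by (auto simp: mono_dvd_iff_lookup_le lookup_single when_def)

lemma mono_diff_add: "mono_dvd a b \<Longrightarrow> b - a + a = b"
  by (intro poly_mapping_eqI) (simp add: mono_dvd_iff_lookup_le lookup_add lookup_minus)

lemma mono_diff_add_diff:
  "mono_dvd a b \<Longrightarrow> mono_dvd b c \<Longrightarrow> (c - b) + (b - a) = c - a"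
  by (intro poly_mapping_eqI) (simp add: mono_dvd_iff_lookup_le lookup_add lookup_minus)

lemma lookup_mono_lcm:
  fixes A :: "('v::finite) mono set"
  shows "lookup (mono_lcm A) x = Max (insert 0 ((\<lambda>a. lookup a x) ` A))"
  unfolding mono_lcm_def by (subst lookup_Abs_poly_mapping) auto

lemma mono_lcm_dvd_iff:
  fixes A :: "('v::finite) mono set"
  assumes "finite A"
  shows "mono_dvd (mono_lcm A) b \<longleftrightarrow> (\<forall>a\<in>A. mono_dvd a b)"
  using assms by (auto simp: mono_dvd_iff_lookup_le lookup_mono_lcm)

text \<open>
  The exponent of \<open>x\<close> in the lcm is attained by one of the monomials.  This fails for divisors that
  involve several variables.
\<close>

lemma var_power_dvd_mono_lcm_iff:
  fixes A :: "('v::finite) mono set"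
  assumes "finite A" "1 \<le> k"
  shows "mono_dvd (single x k) (mono_lcm A) \<longleftrightarrow> (\<exists>a\<in>A. mono_dvd (single x k) a)"
  using assms by (auto simp: mono_dvd_single_iff lookup_mono_lcm Max_ge_iff)

lemma mono_lcm_empty [simp]: "mono_lcm {} = (0 :: ('v::finite) mono)"
  and mono_lcm_singleton [simp]: "mono_lcm {a} = (a :: ('v::finite) mono)"
  by (rule poly_mapping_eqI; simp add: lookup_mono_lcm)+

lemma mono_lcm_insert_absorb:
  fixes A :: "('v::finite) mono set"
  assumes "finite A" "mono_dvd a (mono_lcm A)"
  shows "mono_lcm (insert a A) = mono_lcm A"
proof (rule poly_mapping_eqI)
  fix x
  let ?S = "insert 0 ((\<lambda>a. lookup a x) ` A)"
  have "Max (insert (lookup a x) ?S) = max (lookup a x) (Max ?S)"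
    using assms(1) by (subst Max_insert) auto
  also have "\<dots> = Max ?S"
    using assms(2) by (intro max_absorb2) (simp add: mono_dvd_iff_lookup_le lookup_mono_lcm)
  finally show "lookup (mono_lcm (insert a A)) x = lookup (mono_lcm A) x"
    by (simp add: lookup_mono_lcm insert_commute)
qed

lemma module_mult: "module ((*) :: 'r::comm_ring_1 \<Rightarrow> 'r \<Rightarrow> 'r)"
  by unfold_locales (auto simp: algebra_simps)

lemma ideal_gen_superset: "p \<in> A \<Longrightarrow> p \<in> ideal_gen A"
  unfolding ideal_gen_def by (rule module.span_base[OF module_mult])

lemma ideal_gen_mult: "p \<in> ideal_gen A \<Longrightarrow> s * p \<in> ideal_gen A"
  unfolding ideal_gen_def by (rule module.span_scale[OF module_mult])

lemma ideal_gen_add: "p \<in> ideal_gen A \<Longrightarrow> q \<in> ideal_gen A \<Longrightarrow> p + q \<in> ideal_gen A"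
  unfolding ideal_gen_def by (rule module.span_add[OF module_mult])

lemma ideal_gen_0: "0 \<in> ideal_gen A"
  unfolding ideal_gen_def by (rule module.span_zero[OF module_mult])

lemma single_in_monomial_ideal:
  assumes "a \<in> A" "mono_dvd a e"
  shows "single e c \<in> ideal_gen (monomial ` A)"
proof -
  have "single e c = single (e - a) c * monomial a"
    using assms(2) by (simp add: monomial_def mult_single mono_diff_add)
  then show ?thesis using assms(1) by (simp add: ideal_gen_mult ideal_gen_superset)
qed

text \<open>
  The polynomials satisfying the right-hand side form an ideal that contains the generators; conversely
  each of their terms is a multiple of a generator.
\<close>

lemma in_monomial_ideal_iff:
  fixes p :: "('v, 'k::field) mpol"
  shows "p \<in> ideal_gen (monomial ` A) \<longleftrightarrow> (\<forall>e\<in>keys p. \<exists>a\<in>A. mono_dvd a e)"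
proof
  let ?N = "{p :: ('v, 'k) mpol. \<forall>e\<in>keys p. \<exists>a\<in>A. mono_dvd a e}"
  have "module.subspace (*) ?N"
    unfolding module.subspace_def[OF module_mult]
  proof (intro conjI ballI allI)
    fix s q :: "('v, 'k) mpol" assume q: "q \<in> ?N"
    have "\<exists>a\<in>A. mono_dvd a e" if "e \<in> keys (s * q)" for e
    proof -
      from that keys_mult[of s q] obtain f g where "e = f + g" "g \<in> keys q" by blast
      with q show ?thesis using mono_dvd_add mono_dvd_trans by blast
    qed
    then show "s * q \<in> ?N" by blast
  next
    fix q r assume "q \<in> ?N" "r \<in> ?N"
    then show "q + r \<in> ?N" using keys_add[of q r] by blast
  qed simp
  moreover have "monomial ` A \<subseteq> ?N"
    by (auto simp: monomial_def) (metis mono_dvd_refl)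
  ultimately have "ideal_gen (monomial ` A) \<subseteq> ?N"
    unfolding ideal_gen_def by (rule module.span_minimal[OF module_mult, rotated])
  then show "p \<in> ideal_gen (monomial ` A) \<Longrightarrow> \<forall>e\<in>keys p. \<exists>a\<in>A. mono_dvd a e" by blast
next
  assume "\<forall>e\<in>keys p. \<exists>a\<in>A. mono_dvd a e"
  then show "p \<in> ideal_gen (monomial ` A)"
    by - (rule poly_mapping_additive_induct[of "\<lambda>p. p \<in> ideal_gen (monomial ` A)"],
      auto intro: ideal_gen_0 ideal_gen_add single_in_monomial_ideal)
qed

lemma monomial_in_monomial_ideal_iff:
  "(monomial e :: ('v, 'k::field) mpol) \<in> ideal_gen (monomial ` A) \<longleftrightarrow> (\<exists>a\<in>A. mono_dvd a e)"
  by (simp add: in_monomial_ideal_iff) (simp add: monomial_def)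

section \<open>Minimal generators\<close>

text \<open>
  The minimal monomials of \<open>M\<close> with respect to divisibility, described without reference to
  generators; the irredundant set of monomial generators is shown to be this set.
\<close>

definition minimal_monos :: "('v, 'k::field) mpol set \<Rightarrow> 'v mono set"
  where "minimal_monos M =
    {e. monomial e \<in> M \<and> (\<forall>e'. monomial e' \<in> M \<and> mono_dvd e' e \<longrightarrow> e' = e)}"

lemma minimal_mono_below:
  fixes M :: "('v::finite, 'k::field) mpol set"
  assumes "monomial e \<in> M"
  shows "\<exists>g\<in>minimal_monos M. mono_dvd g e"
  using assms
proof (induction "\<Sum>x\<in>UNIV. lookup e x" arbitrary: e rule: less_induct)
  case less
  show ?case
  proof (cases "e \<in> minimal_monos M")
    case False
    then obtain e' where e': "monomial e' \<in> M" "mono_dvd e' e" "e' \<noteq> e"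
      using less.prems by (auto simp: minimal_monos_def)
    from \<open>e' \<noteq> e\<close> obtain x where "lookup e' x \<noteq> lookup e x"
      by (auto simp: poly_mapping_eq_iff fun_eq_iff)
    with e'(2) have "(\<Sum>x\<in>UNIV. lookup e' x) < (\<Sum>x\<in>UNIV. lookup e x)"
      by (intro sum_strict_mono_ex1) (auto simp: mono_dvd_iff_lookup_le intro!: bexI[of _ x] le_neq_implies_less)
    from less.hyps[OF this e'(1)] e'(2) show ?thesis
      using mono_dvd_trans by blast
  qed (metis mono_dvd_refl)
qed

lemma ideal_gen_minimal_monos:
  fixes M :: "('v::finite, 'k::field) mpol set"
  assumes "monomial_ideal M"
  shows "ideal_gen (monomial ` minimal_monos M) = M"
proof -
  obtain A where M: "M = ideal_gen (monomial ` A)"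
    using assms by (auto simp: monomial_ideal_def)
  have "p \<in> M \<longleftrightarrow> p \<in> ideal_gen (monomial ` minimal_monos M)" for p
  proof
    assume p: "p \<in> M"
    have "\<exists>g\<in>minimal_monos M. mono_dvd g e" if "e \<in> keys p" for e
    proof (rule minimal_mono_below)
      show "monomial e \<in> M"
        using p that by (simp add: M monomial_in_monomial_ideal_iff) (simp add: in_monomial_ideal_iff)
    qed
    then show "p \<in> ideal_gen (monomial ` minimal_monos M)"
      by (simp add: in_monomial_ideal_iff)
  next
    assume "p \<in> ideal_gen (monomial ` minimal_monos M)"
    then have *: "\<exists>g\<in>minimal_monos M. mono_dvd g e" if "e \<in> keys p" for e
      using that by (simp add: in_monomial_ideal_iff)
    have "\<exists>a\<in>A. mono_dvd a g" if "g \<in> minimal_monos M" for g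
      using that by (simp add: minimal_monos_def M monomial_in_monomial_ideal_iff)
    with * have "\<forall>e\<in>keys p. \<exists>a\<in>A. mono_dvd a e" using mono_dvd_trans by blast
    then show "p \<in> M" by (simp add: M in_monomial_ideal_iff)
  qed
  then show ?thesis by blast
qed

text \<open>
  Any set of monomial generators contains the minimal monomials, since these are divisible only by
  themselves among the monomials of \<open>M\<close>.  They already generate \<open>M\<close>, so irredundance leaves no room
  for more.
\<close>

lemma is_min_gens_iff:
  fixes M :: "('v::finite, 'k::field) mpol set"
  assumes "monomial_ideal M"
  shows "is_min_gens M G \<longleftrightarrow> G = minimal_monos M"
proof
  assume G: "is_min_gens M G"
  have "minimal_monos M \<subseteq> G"
  proof
    fix e assume e: "e \<in> minimal_monos M"
    have M: "M = ideal_gen (monomial ` G)" using G by (simp add: is_min_gens_def)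
    from e obtain g where "g \<in> G" "mono_dvd g e"
      by (auto simp: minimal_monos_def M monomial_in_monomial_ideal_iff)
    moreover from \<open>g \<in> G\<close> have "monomial g \<in> M"
      unfolding M by (simp add: ideal_gen_superset)
    ultimately show "e \<in> G" using e by (auto simp: minimal_monos_def)
  qed
  then show "G = minimal_monos M"
    using G ideal_gen_minimal_monos[OF assms] by (auto simp: is_min_gens_def)
next
  have "ideal_gen (monomial ` H) \<noteq> M" if "H \<subset> minimal_monos M" for H
  proof
    assume M: "ideal_gen (monomial ` H) = M"
    from that obtain g where g: "g \<in> minimal_monos M" "g \<notin> H" by blast
    then obtain h where h: "h \<in> H" "mono_dvd h g"
      unfolding minimal_monos_def M[symmetric] monomial_in_monomial_ideal_iff by blast
    then have "monomial h \<in> M" unfolding M[symmetric] by (simp add: ideal_gen_superset)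
    with h g show False by (auto simp: minimal_monos_def)
  qed
  then show "G = minimal_monos M \<Longrightarrow> is_min_gens M G"
    using ideal_gen_minimal_monos[OF assms] by (auto simp: is_min_gens_def)
qed

lemma ideal_gen_min_gens:
  fixes M :: "('v::finite, 'k::field) mpol set"
  assumes "monomial_ideal M"
  shows "ideal_gen (monomial ` min_gens M) = M"
  using is_min_gens_iff[OF assms] ideal_gen_minimal_monos[OF assms]
  by (simp add: min_gens_def)

text \<open>
  If \<open>m\<close> and \<open>m'\<close> were dominant through the same variable, each would have a larger exponent there
  than the other.  So there are at most as many dominant elements as variables.
\<close>

lemma finite_dominant:
  fixes G :: "('v::finite) mono set"
  shows "finite {m. dominant G m}"
proof -
  have "\<exists>x. \<forall>m'\<in>G - {m}. lookup m' x < lookup m x" if "dominant G m" for m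
  proof -
    from that obtain x k where "k \<le> lookup m x" "\<And>m'. m' \<in> G - {m} \<Longrightarrow> \<not> k \<le> lookup m' x"
      by (auto simp: dominant_def mono_dvd_single_iff)
    then have "\<forall>m'\<in>G - {m}. lookup m' x < lookup m x" by fastforce
    then show ?thesis ..
  qed
  then obtain x where x: "\<And>m m'. dominant G m \<Longrightarrow> m' \<in> G - {m} \<Longrightarrow> lookup m' (x m) < lookup m (x m)"
    by metis
  have "inj_on x {m. dominant G m}"
  proof (rule inj_onI, rule ccontr)
    fix m m' assume *: "m \<in> {m. dominant G m}" "m' \<in> {m. dominant G m}" "x m = x m'" "m \<noteq> m'"
    then have "m \<in> G" "m' \<in> G" by (auto simp: dominant_def)
    with * x[of m m'] x[of m' m] show False by auto
  qed
  then show ?thesis by (rule inj_on_finite[where B = UNIV]) auto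
qed

lemma finite_semidominant_set:
  fixes G :: "('v::finite) mono set"
  assumes "semidominant_set G"
  shows "finite G"
proof -
  from assms obtain m where "\<And>m'. m' \<in> G \<Longrightarrow> \<not> dominant G m' \<Longrightarrow> m' = m"
    by (auto simp: semidominant_set_def)
  then have "G \<subseteq> insert m {m. dominant G m}" by blast
  then show ?thesis using finite_dominant finite_subset by blast
qed

section \<open>The Taylor differential in a fixed multidegree\<close>

lemma mono_dvd_taylor_mdeg_iff:
  assumes "finite \<sigma>"
  shows "mono_dvd (taylor_mdeg ls \<sigma>) b \<longleftrightarrow> (\<forall>r\<in>\<sigma>. mono_dvd (ls ! r) b)"
  using assms by (simp add: taylor_mdeg_def mono_lcm_dvd_iff)

lemma taylor_mdeg_mono:
  assumes "finite \<tau>" "\<sigma> \<subseteq> \<tau>"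
  shows "mono_dvd (taylor_mdeg ls \<sigma>) (taylor_mdeg ls \<tau>)"
  using assms finite_subset[OF assms(2,1)]
    mono_dvd_taylor_mdeg_iff[OF assms(1), of ls "taylor_mdeg ls \<tau>"]
  by (auto simp: mono_dvd_taylor_mdeg_iff mono_dvd_refl)

text \<open>
  The sign of the facet \<open>\<sigma> - {r}\<close> in the boundary of the simplex \<open>\<sigma>\<close>.
\<close>

definition face_sign :: "nat \<Rightarrow> nat set \<Rightarrow> 'k::comm_ring_1"
  where "face_sign r \<sigma> = (-1) ^ card {s \<in> \<sigma>. s < r}"

lemma face_sign_square: "face_sign r \<sigma> * face_sign r \<sigma> = 1"
  by (simp add: face_sign_def flip: power_mult_distrib)

text \<open>
  This sign change makes the terms of \<open>d h\<close> and \<open>h d\<close> cancel when \<open>h\<close> inserts \<open>v\<close>.  Inserting \<open>v\<close>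
  moves \<open>r\<close> up by one place if \<open>v < r\<close>, and removing \<open>r\<close> moves \<open>v\<close> down by one place if \<open>r < v\<close>, so
  exactly one of the two signs changes.
\<close>

lemma face_sign_swap:
  assumes "finite \<sigma>" "v \<notin> \<sigma>" "r \<in> \<sigma>"
  shows "face_sign r (insert v \<sigma>) * face_sign v (insert v \<sigma>)
    = - (face_sign v (insert v (\<sigma> - {r})) * face_sign r \<sigma>)"
proof -
  from assms consider "v < r" | "r < v" by (metis linorder_neqE_nat)
  then show ?thesis
  proof cases
    case 1
    then have "{s \<in> insert v \<sigma>. s < r} = insert v {s \<in> \<sigma>. s < r}"
      and "{s \<in> insert v \<sigma>. s < v} = {s \<in> insert v (\<sigma> - {r}). s < v}" by auto
    then show ?thesis using assms by (simp add: face_sign_def)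
  next
    case 2
    then have "{s \<in> insert v \<sigma>. s < v} = insert r {s \<in> insert v (\<sigma> - {r}). s < v}"
      and "{s \<in> insert v \<sigma>. s < r} = {s \<in> \<sigma>. s < r}" using assms by auto
    then show ?thesis using assms by (simp add: face_sign_def)
  qed
qed

lemma taylor_diff_basis_face_sign:
  fixes ls :: "('v::finite) mono list"
  shows "(taylor_diff_basis ls \<sigma> :: nat set \<Rightarrow>\<^sub>0 ('v, 'k::field) mpol) =
    (\<Sum>r\<in>\<sigma>. single (\<sigma> - {r}) (single (taylor_mdeg ls \<sigma> - taylor_mdeg ls (\<sigma> - {r})) (face_sign r \<sigma>)))"
proof -
  have "(- 1) ^ n * monomial a = (single a ((- 1) ^ n) :: ('v, 'k) mpol)" for n and a :: "'v mono"
    by (cases "even n") (simp_all add: monomial_def single_uminus)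
  then show ?thesis by (simp add: taylor_diff_basis_def face_sign_def)
qed

lemma taylor_diff_additive_ext:
  "taylor_diff ls = additive_ext (\<lambda>\<sigma> s. fscale s (taylor_diff_basis ls \<sigma>))"
  by (rule ext) (simp add: taylor_diff_def additive_ext_def)

lemma taylor_diff_add: "taylor_diff ls (c + c') = taylor_diff ls c + taylor_diff ls c'"
  by (simp add: taylor_diff_additive_ext additive_ext_add fscale_add_left)

lemma taylor_diff_0 [simp]: "taylor_diff ls 0 = 0"
  by (simp add: taylor_diff_additive_ext)

lemma taylor_diff_single: "taylor_diff ls (single \<sigma> s) = fscale s (taylor_diff_basis ls \<sigma>)"
  by (simp add: taylor_diff_additive_ext additive_ext_single)

lemma taylor_diff_sum: "taylor_diff ls (sum f I) = (\<Sum>i\<in>I. taylor_diff ls (f i))"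
  by (induction I rule: infinite_finite_induct) (auto simp: taylor_diff_add)

lemma taylor_diff_fscale: "taylor_diff ls (fscale s c) = fscale s (taylor_diff ls c)"
  by (rule poly_mapping_additive_induct)
    (auto simp: fscale_add taylor_diff_add fscale_single taylor_diff_single fscale_fscale)

text \<open>
  The basis element \<open>[\<sigma>]\<close> shifted to total multidegree \<open>b\<close>.  For fixed \<open>b\<close> these chains, with \<open>\<sigma>\<close>
  ranging over the sets whose lcm divides \<open>b\<close>, turn the Taylor differential into the ordinary
  boundary map of a simplex over the field: the monomial coefficients disappear.  For other \<open>\<sigma>\<close>
  the subtraction is truncated and the total multidegree is not \<open>b\<close>.
\<close>

definition strand :: "('v::finite) mono list \<Rightarrow> 'v mono \<Rightarrow> nat set \<Rightarrow> 'k \<Rightarrow> (nat set \<Rightarrow>\<^sub>0 ('v, 'k::field) mpol)"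
  where "strand ls b \<sigma> a = single \<sigma> (single (b - taylor_mdeg ls \<sigma>) a)"

lemma single_eq_strand: "single \<sigma> (single e a) = strand ls (e + taylor_mdeg ls \<sigma>) \<sigma> a"
  by (simp add: strand_def)

lemma strand_uminus: "strand ls b \<sigma> (- a) = - strand ls b \<sigma> a"
  by (simp add: strand_def single_uminus)

lemma taylor_diff_strand:
  assumes "finite \<sigma>" "mono_dvd (taylor_mdeg ls \<sigma>) b"
  shows "taylor_diff ls (strand ls b \<sigma> a) = (\<Sum>r\<in>\<sigma>. strand ls b (\<sigma> - {r}) (face_sign r \<sigma> * a))"
proof -
  have "b - taylor_mdeg ls \<sigma> + (taylor_mdeg ls \<sigma> - taylor_mdeg ls (\<sigma> - {r})) = b - taylor_mdeg ls (\<sigma> - {r})" for r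
    by (rule mono_diff_add_diff) (use assms in \<open>auto intro: taylor_mdeg_mono\<close>)
  then show ?thesis
    by (simp add: strand_def taylor_diff_single taylor_diff_basis_face_sign fscale_sum fscale_single
        mult_single mult.commute)
qed

section \<open>Contraction by inserting a vertex\<close>

text \<open>
  The contracting homotopy: in multidegree \<open>b\<close> the vertex \<open>v b\<close> is inserted with the sign it has as a
  member of the larger simplex, and simplices that already contain it are sent to \<open>0\<close>.
\<close>

definition insert_vertex ::
    "('v::finite) mono list \<Rightarrow> ('v mono \<Rightarrow> nat) \<Rightarrow> (nat set \<Rightarrow>\<^sub>0 ('v, 'k::field) mpol) \<Rightarrow> (nat set \<Rightarrow>\<^sub>0 ('v, 'k) mpol)"
  where "insert_vertex ls v = additive_ext (\<lambda>\<sigma>. additive_ext (\<lambda>e a.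
    let b = e + taylor_mdeg ls \<sigma>; \<tau> = insert (v b) \<sigma>
    in if v b \<in> \<sigma> then 0 else strand ls b \<tau> (face_sign (v b) \<tau> * a)))"

lemma insert_vertex_add: "insert_vertex ls v (c + c') = insert_vertex ls v c + insert_vertex ls v c'"
  unfolding insert_vertex_def
  by (intro additive_ext_add additive_ext_0)
    (auto simp: Let_def strand_def algebra_simps single_add)

lemma insert_vertex_0 [simp]: "insert_vertex ls v 0 = 0"
  by (simp add: insert_vertex_def)

lemma insert_vertex_sum: "insert_vertex ls v (sum f I) = (\<Sum>i\<in>I. insert_vertex ls v (f i))"
  by (induction I rule: infinite_finite_induct) (auto simp: insert_vertex_add)

lemma insert_vertex_strand:
  assumes "mono_dvd (taylor_mdeg ls \<sigma>) b"
  shows "insert_vertex ls v (strand ls b \<sigma> a) =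
    (if v b \<in> \<sigma> then 0 else strand ls b (insert (v b) \<sigma>) (face_sign (v b) (insert (v b) \<sigma>) * a))"
  unfolding insert_vertex_def strand_def
  by (subst additive_ext_single, simp, subst additive_ext_single)
    (auto simp: Let_def mono_diff_add[OF assms])

text \<open>
  If \<open>v b \<in> \<sigma>\<close>, only the facet omitting \<open>v b\<close> survives in \<open>h d\<close>, and it gives back \<open>\<sigma>\<close>.  Otherwise
  \<open>d h\<close> gives back \<open>\<sigma>\<close> by omitting the new vertex, and its other terms cancel against \<open>h d\<close>.
\<close>

lemma insert_vertex_homotopy:
  fixes a :: "'k::field"
  assumes "finite \<sigma>" "mono_dvd (taylor_mdeg ls \<sigma>) b" "mono_dvd (ls ! v b) b"
  shows "taylor_diff ls (insert_vertex ls v (strand ls b \<sigma> a))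
    + insert_vertex ls v (taylor_diff ls (strand ls b \<sigma> a)) = strand ls b \<sigma> a"
proof -
  let ?T = "strand ls b" and ?v = "v b"
  have faces: "mono_dvd (taylor_mdeg ls (\<sigma> - {r})) b" for r
    using assms by (auto simp: mono_dvd_taylor_mdeg_iff)
  have hd: "insert_vertex ls v (taylor_diff ls (?T \<sigma> a)) =
      (\<Sum>r\<in>\<sigma>. insert_vertex ls v (?T (\<sigma> - {r}) (face_sign r \<sigma> * a)))"
    using assms by (simp add: taylor_diff_strand insert_vertex_sum)
  show ?thesis
  proof (cases "?v \<in> \<sigma>")
    case True
    have "insert_vertex ls v (taylor_diff ls (?T \<sigma> a)) =
        (\<Sum>r\<in>\<sigma>. if ?v = r then ?T \<sigma> a else 0)"
      unfolding hd
      by (rule sum.cong)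
        (use True in \<open>auto simp: insert_vertex_strand faces insert_absorb face_sign_square
          simp flip: mult.assoc\<close>)
    also have "\<dots> = ?T \<sigma> a" using True assms(1) by simp
    finally show ?thesis using True assms by (simp add: insert_vertex_strand)
  next
    case False
    let ?\<tau> = "insert ?v \<sigma>"
    have dvd: "mono_dvd (taylor_mdeg ls ?\<tau>) b"
      using assms by (simp add: mono_dvd_taylor_mdeg_iff)
    have "taylor_diff ls (insert_vertex ls v (?T \<sigma> a)) =
        (\<Sum>r\<in>?\<tau>. ?T (?\<tau> - {r}) (face_sign r ?\<tau> * (face_sign ?v ?\<tau> * a)))"
      using assms False dvd by (simp add: insert_vertex_strand taylor_diff_strand)
    also have "\<dots> = ?T \<sigma> a + (\<Sum>r\<in>\<sigma>. ?T (?\<tau> - {r}) (face_sign r ?\<tau> * (face_sign ?v ?\<tau> * a)))"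
      using assms(1) False by (simp add: face_sign_square flip: mult.assoc)
    also have "(\<Sum>r\<in>\<sigma>. ?T (?\<tau> - {r}) (face_sign r ?\<tau> * (face_sign ?v ?\<tau> * a))) =
        (\<Sum>r\<in>\<sigma>. - insert_vertex ls v (?T (\<sigma> - {r}) (face_sign r \<sigma> * a)))"
    proof (rule sum.cong)
      fix r assume r: "r \<in> \<sigma>"
      with False have "?\<tau> - {r} = insert ?v (\<sigma> - {r})" by auto
      with r False assms(1) show "?T (?\<tau> - {r}) (face_sign r ?\<tau> * (face_sign ?v ?\<tau> * a)) =
          - insert_vertex ls v (?T (\<sigma> - {r}) (face_sign r \<sigma> * a))"
        by (simp add: insert_vertex_strand faces face_sign_swap flip: mult.assoc strand_uminus)
    qed simp
    finally show ?thesis by (simp add: hd sum_negf)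
  qed
qed

text \<open>
  The homotopy formula spares the usual pairing of double facets.  A nonempty simplex is \<open>h y\<close>, with
  \<open>h\<close> the insertion of one of its vertices \<open>v\<close>, and \<open>y\<close> the smaller simplex without \<open>v\<close>, up to sign.
  Then \<open>d h y = y - h d y\<close>, and \<open>d h d y = d y - h d d y = d y\<close> because \<open>d d y = 0\<close> by induction.
  Hence \<open>d d h y = d y - d h d y = 0\<close>.
\<close>

lemma taylor_diff_diff_strand:
  fixes a :: "'k::field"
  assumes "finite \<sigma>" "mono_dvd (taylor_mdeg ls \<sigma>) b"
  shows "taylor_diff ls (taylor_diff ls (strand ls b \<sigma> a)) = 0"
  using assms
proof (induction \<sigma> arbitrary: a rule: finite_induct)
  case empty
  then show ?case by (simp add: taylor_diff_strand)
next
  case (insert v \<sigma>)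
  \<comment> \<open>The vertex does not depend on the multidegree here, as everything happens in multidegree \<open>b\<close>.\<close>
  let ?h = "insert_vertex ls (\<lambda>_. v)" and ?d = "taylor_diff ls"
  let ?y = "strand ls b \<sigma> (face_sign v (insert v \<sigma>) * a)"
  from insert.prems insert.hyps have dvd: "mono_dvd (taylor_mdeg ls \<sigma>) b" "mono_dvd (ls ! v) b"
    by (simp_all add: mono_dvd_taylor_mdeg_iff)
  have y: "?h ?y = strand ls b (insert v \<sigma>) a"
    using insert.hyps dvd by (simp add: insert_vertex_strand face_sign_square flip: mult.assoc)
  have dhy: "?d (?h ?y) + ?h (?d ?y) = ?y"
    using insert.hyps dvd by (intro insert_vertex_homotopy) auto
  have "?d (?h (?d ?y)) + ?h (?d (?d ?y)) = ?d ?y"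
  proof -
    have "?d (?h (strand ls b (\<sigma> - {r}) a')) + ?h (?d (strand ls b (\<sigma> - {r}) a')) = strand ls b (\<sigma> - {r}) a'" for r and a' :: 'k
      using insert.hyps dvd by (intro insert_vertex_homotopy) (auto simp: mono_dvd_taylor_mdeg_iff)
    then show ?thesis
      using insert.hyps dvd
      by (simp add: taylor_diff_strand taylor_diff_sum insert_vertex_sum flip: sum.distrib)
  qed
  moreover have "?d (?d ?y) = 0" by (rule insert.IH[OF dvd(1)])
  ultimately have "?d (?h (?d ?y)) = ?d ?y" by simp
  moreover have "?d (?d (?h ?y)) + ?d (?h (?d ?y)) = ?d ?y"
    using arg_cong[OF dhy, of ?d] by (simp add: taylor_diff_add)
  ultimately show ?case by (simp add: y)
qed

lemma taylor_diff_diff: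
  assumes "\<And>\<sigma>. \<sigma> \<in> keys c \<Longrightarrow> finite \<sigma>"
  shows "taylor_diff ls (taylor_diff ls c) = 0"
  by (rule poly_chain_additive_induct[where P = "\<lambda>c. taylor_diff ls (taylor_diff ls c) = 0" and c = c])
    (auto simp: taylor_diff_add single_eq_strand[of _ _ _ ls] mono_dvd_add
      intro!: taylor_diff_diff_strand assms)

section \<open>Contractible subcomplexes of the Taylor complex\<close>

text \<open>
  The homotopy formula for all chains of a family \<open>\<Delta>\<close> that is stable under the insertions.  The
  condition on the degrees of \<open>c\<close> says that \<open>v\<close> provides a vertex in each multidegree where \<open>c\<close> is
  nonzero; unless the ideal is the whole ring, it excludes nonzero constants in homological degree \<open>0\<close>.
\<close>

lemma insert_vertex_contraction:
  fixes c :: "nat set \<Rightarrow>\<^sub>0 ('v::finite, 'k::field) mpol"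
  assumes fin: "\<And>\<sigma>. \<sigma> \<in> \<Delta> \<Longrightarrow> finite \<sigma>"
    and vertex: "\<And>b. \<exists>l\<in>set ls. mono_dvd l b \<Longrightarrow> mono_dvd (ls ! v b) b"
    and cone: "\<And>b \<sigma>. \<exists>l\<in>set ls. mono_dvd l b \<Longrightarrow> \<sigma> \<in> \<Delta> \<Longrightarrow> mono_dvd (taylor_mdeg ls \<sigma>) b
      \<Longrightarrow> insert (v b) \<sigma> \<in> \<Delta>"
    and c: "c \<in> free_on {\<sigma> \<in> \<Delta>. card \<sigma> = j}"
    and deg: "\<And>\<sigma> e. \<sigma> \<in> keys c \<Longrightarrow> e \<in> keys (lookup c \<sigma>) \<Longrightarrow>
      \<exists>l\<in>set ls. mono_dvd l (e + taylor_mdeg ls \<sigma>)"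
  shows "taylor_diff ls (insert_vertex ls v c) + insert_vertex ls v (taylor_diff ls c) = c \<and>
    insert_vertex ls v c \<in> free_on {\<sigma> \<in> \<Delta>. card \<sigma> = Suc j}"
proof (rule poly_chain_additive_induct[where c = c])
  fix \<sigma> e and a :: 'k
  assume *: "\<sigma> \<in> keys c" "e \<in> keys (lookup c \<sigma>)"
  let ?b = "e + taylor_mdeg ls \<sigma>"
  from * c have \<sigma>: "\<sigma> \<in> \<Delta>" "card \<sigma> = j" by (auto simp: free_on_def)
  have b: "\<exists>l\<in>set ls. mono_dvd l ?b" by (rule deg[OF *])
  have "taylor_diff ls (insert_vertex ls v (strand ls ?b \<sigma> a))
    + insert_vertex ls v (taylor_diff ls (strand ls ?b \<sigma> a)) = strand ls ?b \<sigma> a"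
    by (intro insert_vertex_homotopy fin \<sigma> vertex b mono_dvd_add)
  moreover have "insert_vertex ls v (strand ls ?b \<sigma> a) \<in> free_on {\<sigma> \<in> \<Delta>. card \<sigma> = Suc j}"
    using cone[OF b \<sigma>(1) mono_dvd_add] fin[OF \<sigma>(1)] \<sigma>(2)
    by (simp add: insert_vertex_strand[OF mono_dvd_add]) (simp add: strand_def free_on_single)
  ultimately show "taylor_diff ls (insert_vertex ls v (single \<sigma> (single e a)))
      + insert_vertex ls v (taylor_diff ls (single \<sigma> (single e a))) = single \<sigma> (single e a) \<and>
      insert_vertex ls v (single \<sigma> (single e a)) \<in> free_on {\<sigma> \<in> \<Delta>. card \<sigma> = Suc j}"
    by (simp add: single_eq_strand[of _ _ _ ls])
next
  fix c c' :: "nat set \<Rightarrow>\<^sub>0 ('v, 'k) mpol"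
  assume 1: "taylor_diff ls (insert_vertex ls v c) + insert_vertex ls v (taylor_diff ls c) = c \<and>
      insert_vertex ls v c \<in> free_on {\<sigma> \<in> \<Delta>. card \<sigma> = Suc j}"
    and 2: "taylor_diff ls (insert_vertex ls v c') + insert_vertex ls v (taylor_diff ls c') = c' \<and>
      insert_vertex ls v c' \<in> free_on {\<sigma> \<in> \<Delta>. card \<sigma> = Suc j}"
  have "taylor_diff ls (insert_vertex ls v (c + c')) + insert_vertex ls v (taylor_diff ls (c + c')) =
    (taylor_diff ls (insert_vertex ls v c) + insert_vertex ls v (taylor_diff ls c)) +
    (taylor_diff ls (insert_vertex ls v c') + insert_vertex ls v (taylor_diff ls c'))"
    by (simp add: taylor_diff_add insert_vertex_add algebra_simps)
  then show "taylor_diff ls (insert_vertex ls v (c + c')) + insert_vertex ls v (taylor_diff ls (c + c')) = c + c' \<and>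
    insert_vertex ls v (c + c') \<in> free_on {\<sigma> \<in> \<Delta>. card \<sigma> = Suc j}"
    using 1 2 by (simp add: insert_vertex_add free_on_add)
qed simp

lemma taylor_diff_free_on:
  assumes faces: "\<And>\<sigma> r. \<sigma> \<in> \<Delta> \<Longrightarrow> r \<in> \<sigma> \<Longrightarrow> \<sigma> - {r} \<in> \<Delta>"
    and c: "c \<in> free_on {\<sigma> \<in> \<Delta>. card \<sigma> = Suc j}"
  shows "taylor_diff ls c \<in> free_on {\<sigma> \<in> \<Delta>. card \<sigma> = j}"
  unfolding taylor_diff_def
proof (rule free_on_sum)
  fix \<sigma> assume "\<sigma> \<in> keys c"
  with c have \<sigma>: "\<sigma> \<in> \<Delta>" "card \<sigma> = Suc j" by (auto simp: free_on_def)
  then show "fscale (lookup c \<sigma>) (taylor_diff_basis ls \<sigma>) \<in> free_on {\<sigma> \<in> \<Delta>. card \<sigma> = j}"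
    unfolding taylor_diff_basis_def fscale_sum fscale_single
    by (intro free_on_sum free_on_single) (auto intro: faces)
qed

lemma taylor_aug_diff_in_ideal:
  assumes "\<And>\<sigma>. \<sigma> \<in> \<Delta> \<Longrightarrow> \<sigma> \<subseteq> {..<length ls}" and c: "c \<in> free_on {\<sigma> \<in> \<Delta>. card \<sigma> = 1}"
  shows "taylor_aug (taylor_diff ls c) \<in> ideal_gen (monomial ` set ls)"
proof (rule poly_chain_additive_induct[of "\<lambda>c. taylor_aug (taylor_diff ls c) \<in> ideal_gen (monomial ` set ls)"])
  fix \<sigma> e a assume "\<sigma> \<in> keys c"
  with c have "\<sigma> \<in> \<Delta>" "card \<sigma> = 1" by (auto simp: free_on_def)
  with assms(1)[of \<sigma>] obtain r where r: "\<sigma> = {r}" "r < length ls" by (auto simp: card_1_singleton_iff)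
  have no_smaller: "{s. s = r \<and> s < r} = {}" by auto
  have "taylor_diff ls (single \<sigma> (single e a)) = single {} (single (e + ls ! r) a)"
    by (simp add: r single_eq_strand[of "{r}" _ _ ls] taylor_diff_strand mono_dvd_add)
      (simp add: strand_def taylor_mdeg_def face_sign_def no_smaller)
  then show "taylor_aug (taylor_diff ls (single \<sigma> (single e a))) \<in> ideal_gen (monomial ` set ls)"
    using r single_in_monomial_ideal[of "ls ! r" "set ls" "e + ls ! r" a]
    by (simp add: taylor_aug_def mono_dvd_add)
qed (auto simp: taylor_diff_add taylor_aug_def lookup_add intro: ideal_gen_0 ideal_gen_add)

text \<open>
  A family of faces closed under taking facets is a subcomplex of the Taylor complex.  It resolves the
  quotient by the ideal as soon as, in each multidegree \<open>b\<close> of the ideal, one vertex \<open>v b\<close> that divides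
  \<open>b\<close> can be added to all of its faces whose multidegree divides \<open>b\<close>.  The last hypothesis accounts for the unit ideal, for which the
  zero complex is a resolution.
\<close>

lemma free_resolution_if_contractible:
  fixes ls :: "('v::finite) mono list"
  assumes sub: "\<And>\<sigma>. \<sigma> \<in> \<Delta> \<Longrightarrow> \<sigma> \<subseteq> {..<length ls}"
    and faces: "\<And>\<sigma> r. \<sigma> \<in> \<Delta> \<Longrightarrow> r \<in> \<sigma> \<Longrightarrow> \<sigma> - {r} \<in> \<Delta>"
    and vertex: "\<And>b. \<exists>l\<in>set ls. mono_dvd l b \<Longrightarrow> mono_dvd (ls ! v b) b"
    and cone: "\<And>b \<sigma>. \<exists>l\<in>set ls. mono_dvd l b \<Longrightarrow> \<sigma> \<in> \<Delta> \<Longrightarrow> mono_dvd (taylor_mdeg ls \<sigma>) b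
      \<Longrightarrow> insert (v b) \<sigma> \<in> \<Delta>"
    and empty: "{} \<in> \<Delta> \<or> 0 \<in> set ls"
  shows "free_resolution (\<lambda>j. {\<sigma> \<in> \<Delta>. card \<sigma> = j}) (taylor_diff ls) taylor_aug
    (ideal_gen (monomial ` set ls) :: ('v, 'k::field) mpol set)"
  unfolding free_resolution_def
proof (intro conjI allI impI)
  let ?B = "\<lambda>j. {\<sigma> \<in> \<Delta>. card \<sigma> = j}" and ?M = "ideal_gen (monomial ` set ls) :: ('v, 'k) mpol set"
  let ?d = "taylor_diff ls :: (_ \<Rightarrow>\<^sub>0 ('v, 'k) mpol) \<Rightarrow> _"
  have fin: "finite \<sigma>" if "\<sigma> \<in> \<Delta>" for \<sigma>
    using sub[OF that] finite_subset by blast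
  show "module_hom fscale fscale ?d"
    by (simp add: module_hom_iff module_fscale taylor_diff_add taylor_diff_fscale)
  show "module_hom fscale (*) (taylor_aug :: (_ \<Rightarrow>\<^sub>0 ('v, 'k) mpol) \<Rightarrow> _)"
    by (simp add: module_hom_iff module_fscale module_mult taylor_aug_def lookup_add lookup_fscale)
  have diff: "?d ` free_on (?B (Suc j)) \<subseteq> free_on (?B j)" for j
    using taylor_diff_free_on[OF faces] by blast
  then show "?d ` free_on (?B (Suc j)) \<subseteq> free_on (?B j)" for j .
  have exact: "c \<in> ?d ` free_on (?B (Suc j))"
    if c: "c \<in> free_on (?B j)" and d: "?d c = 0"
      and deg: "\<And>\<sigma> e. \<sigma> \<in> keys c \<Longrightarrow> e \<in> keys (lookup c \<sigma>) \<Longrightarrow>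
        \<exists>l\<in>set ls. mono_dvd l (e + taylor_mdeg ls \<sigma>)" for c j
    using insert_vertex_contraction[of \<Delta> ls v c j, OF fin vertex cone c deg] d by force
  show "{c \<in> free_on (?B j). ?d c = 0} = ?d ` free_on (?B (Suc j))" if "1 \<le> j" for j
  proof (intro equalityI subsetI)
    fix c assume "c \<in> {c \<in> free_on (?B j). ?d c = 0}"
    then have c: "c \<in> free_on (?B j)" "?d c = 0" by auto
    show "c \<in> ?d ` free_on (?B (Suc j))"
    proof (rule exact[OF c])
      fix \<sigma> e assume "\<sigma> \<in> keys c"
      with c(1) have "\<sigma> \<in> \<Delta>" "\<sigma> \<noteq> {}" using that by (auto simp: free_on_def)
      then obtain r where "r \<in> \<sigma>" "r < length ls" using sub by blast
      moreover have "mono_dvd (ls ! r) (e + taylor_mdeg ls \<sigma>)"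
        using mono_dvd_add[of "taylor_mdeg ls \<sigma>" e] \<open>r \<in> \<sigma>\<close> fin[OF \<open>\<sigma> \<in> \<Delta>\<close>]
        by (simp add: mono_dvd_taylor_mdeg_iff)
      ultimately show "\<exists>l\<in>set ls. mono_dvd l (e + taylor_mdeg ls \<sigma>)" by auto
    qed
  next
    fix c assume "c \<in> ?d ` free_on (?B (Suc j))"
    then obtain c' where c': "c = ?d c'" "c' \<in> free_on (?B (Suc j))" by blast
    moreover from c'(2) have "?d (?d c') = 0"
      by (intro taylor_diff_diff) (auto simp: free_on_def intro: fin)
    ultimately show "c \<in> {c \<in> free_on (?B j). ?d c = 0}" using diff by blast
  qed
  show "{c \<in> free_on (?B 0). taylor_aug c \<in> ?M} = ?d ` free_on (?B 1)"
  proof (intro equalityI subsetI)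
    fix c :: "nat set \<Rightarrow>\<^sub>0 ('v, 'k) mpol"
    assume "c \<in> {c \<in> free_on (?B 0). taylor_aug c \<in> ?M}"
    then have c: "c \<in> free_on (?B 0)" "lookup c {} \<in> ?M" by (auto simp: taylor_aug_def)
    from c(1) have only_empty: "\<sigma> = {}" if "\<sigma> \<in> keys c" for \<sigma>
      using that fin by (auto simp: free_on_def)
    have "?d c = 0"
      by (auto simp: taylor_diff_def taylor_diff_basis_def intro!: sum.neutral dest!: only_empty)
    moreover have "\<exists>l\<in>set ls. mono_dvd l (e + taylor_mdeg ls \<sigma>)"
      if "\<sigma> \<in> keys c" "e \<in> keys (lookup c \<sigma>)" for \<sigma> e
      using only_empty[OF that(1)] that(2) c(2) by (auto simp: in_monomial_ideal_iff taylor_mdeg_def)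
    ultimately show "c \<in> ?d ` free_on (?B 1)" using exact[of c 0] c(1) by simp
  next
    fix c assume "c \<in> ?d ` free_on (?B 1)"
    then show "c \<in> {c \<in> free_on (?B 0). taylor_aug c \<in> ?M}"
      using diff[of 0] taylor_aug_diff_in_ideal[of \<Delta> ls, OF sub] by auto
  qed
  show "\<exists>c\<in>free_on (?B 0). s - taylor_aug c \<in> ?M" for s
    using empty
  proof
    assume "{} \<in> \<Delta>"
    then show ?thesis
      by (intro bexI[of _ "single {} s"]) (auto simp: taylor_aug_def ideal_gen_0 intro: free_on_single)
  next
    assume "0 \<in> set ls"
    then have "s \<in> ?M"
      by (auto simp: in_monomial_ideal_iff mono_dvd_iff_lookup_le intro!: bexI[of _ 0])
    then show ?thesis by (intro bexI[of _ 0]) (auto simp: taylor_aug_def)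
  qed
qed

lemma finite_taylor_basis: "\<sigma> \<in> taylor_basis ls j \<Longrightarrow> finite \<sigma>"
  by (auto simp: taylor_basis_def dest: finite_subset[OF _ finite_lessThan])

lemma multigraded_taylor_diff:
  fixes ls :: "('v::finite) mono list"
  assumes sub: "\<And>j. B j \<subseteq> taylor_basis ls j"
  shows "multigraded B (taylor_mdeg ls) (taylor_diff ls)
    (taylor_aug :: (nat set \<Rightarrow>\<^sub>0 ('v, 'k::field) mpol) \<Rightarrow> _)"
  unfolding multigraded_def
proof (intro conjI allI ballI)
  fix j \<sigma> \<tau> e
  assume \<sigma>: "\<sigma> \<in> B (Suc j)"
    and e: "e \<in> keys (lookup (taylor_diff ls (single \<sigma> 1) :: nat set \<Rightarrow>\<^sub>0 ('v, 'k) mpol) \<tau>)"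
  from \<sigma> sub have "finite \<sigma>" by (blast intro: finite_taylor_basis)
  let ?f = "\<lambda>r. lookup (single (\<sigma> - {r})
    (single (taylor_mdeg ls \<sigma> - taylor_mdeg ls (\<sigma> - {r})) (face_sign r \<sigma> :: 'k))) \<tau>"
  from e have "e \<in> keys (sum ?f \<sigma>)"
    by (simp add: taylor_diff_single taylor_diff_basis_face_sign fscale_sum fscale_single lookup_sum)
  then obtain r where "e \<in> keys (?f r)"
    using keys_sum[of ?f \<sigma>] by blast
  then have "\<tau> = \<sigma> - {r}" "e = taylor_mdeg ls \<sigma> - taylor_mdeg ls (\<sigma> - {r})"
    by (auto simp: lookup_single when_def split: if_splits)
  then show "e + taylor_mdeg ls \<tau> = taylor_mdeg ls \<sigma>"
    using \<open>finite \<sigma>\<close> by (simp add: mono_diff_add taylor_mdeg_mono)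
next
  fix \<sigma> e
  assume \<sigma>: "\<sigma> \<in> B 0"
    and e: "e \<in> keys (taylor_aug (single \<sigma> 1) :: ('v, 'k) mpol)"
  from \<sigma> sub have "\<sigma> \<in> taylor_basis ls 0" by blast
  then have "finite \<sigma>" "card \<sigma> = 0"
    by (rule finite_taylor_basis, simp add: taylor_basis_def)
  then have "\<sigma> = {}" by simp
  with e show "e = taylor_mdeg ls \<sigma>" by (simp add: taylor_aug_def taylor_mdeg_def)
qed

lemma single_in_irrelevant_ideal:
  fixes e :: "('v::finite) mono"
  assumes "e \<noteq> 0"
  shows "single e a \<in> irrelevant_ideal"
proof -
  from assms obtain x where "lookup e x \<noteq> 0"
    by (auto simp: poly_mapping_eq_iff fun_eq_iff)
  then have "mono_dvd (single x 1) e" by (simp add: mono_dvd_single_iff)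
  then have "single e a \<in> ideal_gen (monomial ` range (\<lambda>x. single x 1))"
    by (intro single_in_monomial_ideal[of "single x 1"]) auto
  then show ?thesis by (simp add: irrelevant_ideal_def image_image)
qed

text \<open>
  A coefficient of the differential is, up to sign, the monomial with exponent the difference of two
  multidegrees.  It lies in the irrelevant ideal once these are different.
\<close>

lemma minimal_complex_taylor_diff:
  fixes ls :: "('v::finite) mono list"
  assumes faces: "\<And>\<sigma> r j. \<sigma> \<in> B (Suc j) \<Longrightarrow> r \<in> \<sigma> \<Longrightarrow> \<sigma> - {r} \<in> B j"
    and jump: "\<And>\<sigma> r j. \<sigma> \<in> B (Suc j) \<Longrightarrow> r \<in> \<sigma> \<Longrightarrow> taylor_mdeg ls (\<sigma> - {r}) \<noteq> taylor_mdeg ls \<sigma>"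
    and fin: "\<And>\<sigma> j. \<sigma> \<in> B j \<Longrightarrow> finite \<sigma>"
  shows "minimal_complex B (taylor_diff ls :: (nat set \<Rightarrow>\<^sub>0 ('v, 'k::field) mpol) \<Rightarrow> _)"
  unfolding minimal_complex_def
proof (intro allI image_subsetI)
  fix j and c :: "nat set \<Rightarrow>\<^sub>0 ('v, 'k) mpol"
  assume c: "c \<in> free_on (B (Suc j))"
  let ?I = "irrelevant_ideal :: ('v, 'k) mpol set"
  let ?G = "{fscale s c | s c. s \<in> ?I \<and> c \<in> free_on (B j)}"
  show "taylor_diff ls c \<in> module.span fscale ?G"
    unfolding taylor_diff_def taylor_diff_basis_face_sign
  proof (intro module.span_sum[OF module_fscale] module.span_scale[OF module_fscale])
    fix \<sigma> r assume "\<sigma> \<in> keys c" and r: "r \<in> \<sigma>"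
    with c have \<sigma>: "\<sigma> \<in> B (Suc j)" by (auto simp: free_on_def)
    let ?e = "taylor_mdeg ls \<sigma> - taylor_mdeg ls (\<sigma> - {r})"
    have "?e + taylor_mdeg ls (\<sigma> - {r}) = taylor_mdeg ls \<sigma>"
      by (intro mono_diff_add taylor_mdeg_mono fin[OF \<sigma>]) auto
    with jump[OF \<sigma> r] have "?e \<noteq> 0" by auto
    then have "single ?e (face_sign r \<sigma>) \<in> ?I"
      by (rule single_in_irrelevant_ideal)
    moreover have "single (\<sigma> - {r}) 1 \<in> free_on (B j)"
      by (intro free_on_single faces \<sigma> r)
    moreover have "single (\<sigma> - {r}) (single ?e (face_sign r \<sigma>)) = fscale (single ?e (face_sign r \<sigma>)) (single (\<sigma> - {r}) 1)"
      by (simp add: fscale_single)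
    ultimately show "single (\<sigma> - {r}) (single ?e (face_sign r \<sigma>)) \<in> module.span fscale ?G"
      by (intro module.span_base[OF module_fscale]) blast
  qed
qed

section \<open>The Scarf complex of a semidominant set\<close>

text \<open>
  The witness \<open>x\<^sup>k\<close> of dominance divides the lcm of a set of generators iff it divides a member, and
  the only candidate is the dominant generator itself.
\<close>

lemma dominant_mem_iff_taylor_mdeg:
  fixes ls :: "('v::finite) mono list"
  assumes "distinct ls" "r < length ls" "dominant (set ls) (ls ! r)"
    and "\<sigma> \<subseteq> {..<length ls}" "\<tau> \<subseteq> {..<length ls}" "taylor_mdeg ls \<sigma> = taylor_mdeg ls \<tau>"
  shows "r \<in> \<sigma> \<longleftrightarrow> r \<in> \<tau>"
proof -
  from assms(3) obtain x k where k: "1 \<le> k" "mono_dvd (single x k) (ls ! r)"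
    and other: "\<And>m. m \<in> set ls - {ls ! r} \<Longrightarrow> \<not> mono_dvd (single x k) m"
    by (auto simp: dominant_def)
  have "r \<in> \<rho> \<longleftrightarrow> mono_dvd (single x k) (taylor_mdeg ls \<rho>)" if "\<rho> \<subseteq> {..<length ls}" for \<rho>
  proof -
    have "mono_dvd (single x k) (ls ! s) \<longleftrightarrow> s = r" if "s < length ls" for s
      using that k(2) other[of "ls ! s"] assms(1,2) by (auto simp: nth_eq_iff_index_eq)
    with that k(1) show ?thesis
      using finite_subset[OF that] by (fastforce simp: taylor_mdeg_def var_power_dvd_mono_lcm_iff)
  qed
  with assms(4-6) show ?thesis by simp
qed

text \<open>
  Sets with the same multidegree agree outside \<open>q\<close>, so a set \<open>\<sigma>\<close> can share its multidegree only with
  the set obtained by adding or removing \<open>q\<close>.  This happens when generator \<open>q\<close> divides the lcm of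
  the rest.
\<close>

lemma scarf_basis_semidominant:
  fixes ls :: "('v::finite) mono list"
  assumes "distinct ls" "q < length ls"
    and dom: "\<And>r. r < length ls \<Longrightarrow> r \<noteq> q \<Longrightarrow> dominant (set ls) (ls ! r)"
  shows "scarf_basis ls j = {\<sigma>. \<sigma> \<subseteq> {..<length ls} \<and>
    \<not> mono_dvd (ls ! q) (taylor_mdeg ls (\<sigma> - {q})) \<and> card \<sigma> = j}"
proof (intro equalityI subsetI)
  fix \<sigma> assume \<sigma>: "\<sigma> \<in> scarf_basis ls j"
  then have sub: "\<sigma> \<subseteq> {..<length ls}" "card \<sigma> = j" by (auto simp: scarf_basis_def taylor_basis_def)
  have unique: "\<tau> = \<sigma>" if "\<tau> \<subseteq> {..<length ls}" "taylor_mdeg ls \<tau> = taylor_mdeg ls \<sigma>" for \<tau>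
    using \<sigma> that by (auto simp: scarf_basis_def taylor_basis_def)
  have "\<not> mono_dvd (ls ! q) (taylor_mdeg ls (\<sigma> - {q}))"
  proof
    assume "mono_dvd (ls ! q) (taylor_mdeg ls (\<sigma> - {q}))"
    then have "taylor_mdeg ls (insert q (\<sigma> - {q})) = taylor_mdeg ls (\<sigma> - {q})"
      unfolding taylor_mdeg_def image_insert using finite_subset[OF sub(1)]
      by (intro mono_lcm_insert_absorb) auto
    then have eq: "taylor_mdeg ls (insert q \<sigma>) = taylor_mdeg ls (\<sigma> - {q})" by simp
    show False
    proof (cases "q \<in> \<sigma>")
      case True
      then have "\<sigma> - {q} = \<sigma>" using unique[of "\<sigma> - {q}"] eq sub by (auto simp: insert_absorb)
      with True show False by blast
    next
      case False
      then have "insert q \<sigma> = \<sigma>" using unique[of "insert q \<sigma>"] eq sub assms(2) by simp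
      with False show False by blast
    qed
  qed
  with sub show "\<sigma> \<in> {\<sigma>. \<sigma> \<subseteq> {..<length ls} \<and> \<not> mono_dvd (ls ! q) (taylor_mdeg ls (\<sigma> - {q})) \<and> card \<sigma> = j}"
    by blast
next
  fix \<sigma>
  assume "\<sigma> \<in> {\<sigma>. \<sigma> \<subseteq> {..<length ls} \<and> \<not> mono_dvd (ls ! q) (taylor_mdeg ls (\<sigma> - {q})) \<and> card \<sigma> = j}"
  then have \<sigma>: "\<sigma> \<subseteq> {..<length ls}" "card \<sigma> = j"
    and q: "\<not> mono_dvd (ls ! q) (taylor_mdeg ls (\<sigma> - {q}))" by auto
  have "\<tau> = \<sigma>" if \<tau>: "\<tau> \<subseteq> {..<length ls}" and eq: "taylor_mdeg ls \<tau> = taylor_mdeg ls \<sigma>" for \<tau>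
  proof -
    have same: "r \<in> \<tau> \<longleftrightarrow> r \<in> \<sigma>" if "r \<noteq> q" for r
      using dominant_mem_iff_taylor_mdeg[OF assms(1) _ dom \<tau> \<sigma>(1) eq] that \<tau> \<sigma>(1)
      by blast
    then have minus: "\<tau> - {q} = \<sigma> - {q}" by blast
    have "q \<in> \<tau> \<longleftrightarrow> q \<in> \<sigma>"
    proof (rule ccontr)
      assume "(q \<in> \<tau>) \<noteq> (q \<in> \<sigma>)"
      then consider "q \<in> \<tau>" "\<tau> - {q} = \<sigma>" | "q \<in> \<sigma>" "\<sigma> - {q} = \<tau>"
        using minus by auto
      then have "mono_dvd (ls ! q) (taylor_mdeg ls (\<sigma> - {q}))"
      proof cases
        case 1
        then show ?thesis
          using taylor_mdeg_mono[of \<tau> "{q}" ls] finite_subset[OF \<tau>] eq minus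
          by (simp add: taylor_mdeg_def)
      next
        case 2
        then show ?thesis
          using taylor_mdeg_mono[of \<sigma> "{q}" ls] finite_subset[OF \<sigma>(1)] eq
          by (simp add: taylor_mdeg_def)
      qed
      with q show False ..
    qed
    with same show ?thesis by (intro set_eqI) metis
  qed
  with \<sigma> show "\<sigma> \<in> scarf_basis ls j" by (auto simp: scarf_basis_def taylor_basis_def)
qed

text \<open>
  The contraction uses the non-dominant generator \<open>m\<close> in the multidegrees that it divides: the
  condition for a Scarf face ignores \<open>m\<close>, so adding \<open>m\<close> preserves it.  In the other multidegrees the
  condition holds for all visible faces, and any visible vertex serves.
\<close>

lemma minimal_free_resolution_scarf:
  fixes ls :: "('v::finite) mono list"
  assumes "distinct ls" "semidominant_set (set ls)"
  shows "minimal_free_resolution (scarf_basis ls) (taylor_mdeg ls) (taylor_diff ls) taylor_aug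
    (ideal_gen (monomial ` set ls) :: ('v, 'k::field) mpol set)"
proof -
  from assms(2) obtain m where m: "m \<in> set ls"
    and dom: "\<And>m'. m' \<in> set ls \<Longrightarrow> m' \<noteq> m \<Longrightarrow> dominant (set ls) m'"
    by (auto simp: semidominant_set_def)
  from m obtain q where q: "q < length ls" "ls ! q = m" by (auto simp: in_set_conv_nth)
  define \<Delta> where "\<Delta> = {\<sigma>. \<sigma> \<subseteq> {..<length ls} \<and> \<not> mono_dvd m (taylor_mdeg ls (\<sigma> - {q}))}"
  have scarf: "scarf_basis ls = (\<lambda>j. {\<sigma> \<in> \<Delta>. card \<sigma> = j})"
    using scarf_basis_semidominant[OF assms(1) q(1)] dom q assms(1)
    by (intro ext) (auto simp: \<Delta>_def nth_eq_iff_index_eq)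
  have sub: "\<sigma> \<subseteq> {..<length ls}" if "\<sigma> \<in> \<Delta>" for \<sigma>
    using that by (simp add: \<Delta>_def)
  have fin: "finite \<sigma>" if "\<sigma> \<in> \<Delta>" for \<sigma>
    using sub[OF that] finite_subset by blast
  have faces: "\<sigma> - {r} \<in> \<Delta>" if "\<sigma> \<in> \<Delta>" "r \<in> \<sigma>" for \<sigma> r
  proof -
    have "mono_dvd (taylor_mdeg ls (\<sigma> - {r} - {q})) (taylor_mdeg ls (\<sigma> - {q}))"
      using fin[OF that(1)] by (intro taylor_mdeg_mono) auto
    with that(1) show ?thesis unfolding \<Delta>_def using mono_dvd_trans by blast
  qed
  \<comment> \<open>In the first case \<open>v b\<close> is the apex of the cone; the choice in the second depends only on \<open>b\<close>, as the homotopy requires.\<close>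
  define v where "v b = (if mono_dvd m b then q else SOME r. r < length ls \<and> mono_dvd (ls ! r) b)" for b
  have v: "v b < length ls \<and> mono_dvd (ls ! v b) b" if "\<exists>l\<in>set ls. mono_dvd l b" for b
  proof (cases "mono_dvd m b")
    case False
    from that have "\<exists>r. r < length ls \<and> mono_dvd (ls ! r) b" by (auto simp: in_set_conv_nth)
    from someI_ex[OF this] False show ?thesis by (simp add: v_def)
  qed (simp add: v_def q)
  have cone: "insert (v b) \<sigma> \<in> \<Delta>"
    if b: "\<exists>l\<in>set ls. mono_dvd l b" and \<sigma>: "\<sigma> \<in> \<Delta>" "mono_dvd (taylor_mdeg ls \<sigma>) b" for b \<sigma>
  proof (cases "mono_dvd m b")
    case True
    with \<sigma>(1) q show ?thesis by (simp add: \<Delta>_def v_def)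
  next
    case False
    have "mono_dvd (taylor_mdeg ls (insert (v b) \<sigma> - {q})) b"
      using v[OF b] \<sigma> fin[OF \<sigma>(1)] by (auto simp: mono_dvd_taylor_mdeg_iff)
    with False have "\<not> mono_dvd m (taylor_mdeg ls (insert (v b) \<sigma> - {q}))"
      using mono_dvd_trans by blast
    with v[OF b] sub[OF \<sigma>(1)] show ?thesis by (simp add: \<Delta>_def)
  qed
  \<comment> \<open>If \<open>m = 1\<close>, not even the empty set is a Scarf face, and the ideal is the whole ring.\<close>
  have empty: "{} \<in> \<Delta> \<or> 0 \<in> set ls"
  proof (cases "mono_dvd m 0")
    case True
    then have "m = 0" by (intro poly_mapping_eqI) (simp add: mono_dvd_iff_lookup_le)
    with m show ?thesis by simp
  qed (simp add: \<Delta>_def taylor_mdeg_def)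
  have jump: "taylor_mdeg ls (\<sigma> - {r}) \<noteq> taylor_mdeg ls \<sigma>"
    if \<sigma>: "\<sigma> \<in> scarf_basis ls (Suc j)" and r: "r \<in> \<sigma>" for \<sigma> r j
  proof
    assume eq: "taylor_mdeg ls (\<sigma> - {r}) = taylor_mdeg ls \<sigma>"
    from \<sigma> have "\<sigma> - {r} \<in> taylor_basis ls (card (\<sigma> - {r}))"
      by (auto simp: scarf_basis_def taylor_basis_def)
    with \<sigma> eq have "\<sigma> - {r} = \<sigma>" unfolding scarf_basis_def by blast
    with r show False by blast
  qed
  have "free_resolution (scarf_basis ls) (taylor_diff ls) taylor_aug
      (ideal_gen (monomial ` set ls) :: ('v, 'k) mpol set)"
    unfolding scarf using v by (intro free_resolution_if_contractible[of \<Delta> ls v] sub faces cone empty) auto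
  moreover have "multigraded (scarf_basis ls) (taylor_mdeg ls) (taylor_diff ls)
      (taylor_aug :: _ \<Rightarrow> ('v, 'k) mpol)"
    by (rule multigraded_taylor_diff) (simp add: scarf_basis_def)
  moreover have "minimal_complex (scarf_basis ls)
      (taylor_diff ls :: (nat set \<Rightarrow>\<^sub>0 ('v, 'k) mpol) \<Rightarrow> _)"
    by (rule minimal_complex_taylor_diff[OF _ jump]) (auto simp: scarf intro: faces fin)
  ultimately show ?thesis by (simp add: minimal_free_resolution_def)
qed

theorem corollary5p9:
  fixes M :: "('v::finite, 'k::field) mpol set"
  assumes "semidominant_ideal M"
  shows "scarf_ideal M"
proof -
  from assms have M: "monomial_ideal M" and G: "semidominant_set (min_gens M)"
    by (auto simp: semidominant_ideal_def)
  have "minimal_free_resolution (scarf_basis ls) (taylor_mdeg ls) (taylor_diff ls) taylor_aug M"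
    if "distinct ls" "set ls = min_gens M" for ls
    using minimal_free_resolution_scarf[of ls, where 'k = 'k] that G ideal_gen_min_gens[OF M] by simp
  with M finite_semidominant_set[OF G] show ?thesis by (simp add: scarf_ideal_def)
qed

end
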